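(* Let $G$ be a Garside group, equipped with a Garside structure, in which roots are unique up to conjugacy. Suppose that there exists an integer $\mathcal R_G$ such that $r(y)\leqslant \mathcal R_G$ for every $y\in G$ which is conjugate to a rigid element and which has a rigid power. Then there exists a finite set of positive integers $\mathcal P_G$ such that for every rigid element $x$ of $G$, the sequence $(|SC(x^n)|)_{n\geqslant 1}$ is periodic, and its period is an element of $\mathcal P_G$.
   Context: A Garside structure on a group $G$ consists of a submonoid $G^+\subset G$ with $G^+\cap (G^+)^{-1}=\{1\}$ and an element $\Delta\in G^+$ (the Garside element) such that: $G^+$ generates $G$ and is atomic (for every $g\in G^+$ the lengths of decompositions of $g$ into nontrivial elements of $G^+$ are bounded); the prefix order $a\preccurlyeq b \Leftrightarrow a^{-1}b\in G^+$ is a lattice order on $G$ (meet $\wedge$, join $\vee$); conjugation by $\Delta$ preserves $G^+$; and the set of simple elements $\{s: 1\preccurlyeq s\preccurlyeq \Delta\}$ is finite and generates $G^+$. A Garside group is a group with a Garside structure. Write $\tau(x)=\Delta^{-1}x\Delta$ and, for $s$ simple, $\partial s=s^{-1}\Delta$. A product $s\cdot t$ of two simple elements is left-weighted if $t\wedge\partial s=1$. Every $x\in G$ has a unique normal form $x=\Delta^p x_1\cdots x_r$ with $p\in\mathbb Z$, each $x_i$ simple and different from $1,\Delta$, and each $x_i\cdot x_{i+1}$ left-weighted. If $r>0$, put $\iota(x)=\tau^{-p}(x_1)$ and $\varphi(x)=x_r$. The element $x$ is rigid if it is a power of $\Delta$ or if $\varphi(x)\cdot\iota(x)$ is left-weighted.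 A rigid power of $y$ means a rigid element $y^k$ with $k\geqslant 1$; if $y$ has a rigid power, $r(y)$ is the smallest positive integer such that $y^{r(y)}$ is rigid. If $x$ is conjugate to a rigid element, $SC(x)$ denotes the (finite) set of all rigid conjugates of $x$. Roots are unique up to conjugacy in $G$ if for all $x_1,x_2\in G$ and all positive integers $k$, $x_1^k=x_2^k$ implies that $x_1$ and $x_2$ are conjugate. A sequence $(a_n)_{n\geqslant1}$ is periodic of period $r$ if $a_{n+r}=a_n$ for all $n\geqslant 1$. *)

theory Defs
  imports "HOL-Algebra.Generated_Groups" "HOL-Algebra.Lattice"
begin

definition conjugate :: "('a, 'b) monoid_scheme \<Rightarrow> 'a \<Rightarrow> 'a \<Rightarrow> bool" where
  "conjugate G x y \<longleftrightarrow> (\<exists>g\<in>carrier G. y = inv\<^bsub>G\<^esub> g \<otimes>\<^bsub>G\<^esub> x \<otimes>\<^bsub>G\<^esub> g)"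

definition roots_unique_up_to_conjugacy :: "('a, 'b) monoid_scheme \<Rightarrow> bool" where
  "roots_unique_up_to_conjugacy G \<longleftrightarrow>
     (\<forall>x1\<in>carrier G. \<forall>x2\<in>carrier G. \<forall>k::nat.
        0 < k \<longrightarrow> x1 [^]\<^bsub>G\<^esub> k = x2 [^]\<^bsub>G\<^esub> k \<longrightarrow> conjugate G x1 x2)"

text \<open>The indexing starts at 1. The number r is a period, not necessarily the least one.\<close>

definition periodic_of_period :: "(nat \<Rightarrow> 'c) \<Rightarrow> nat \<Rightarrow> bool" where
  "periodic_of_period a r \<longleftrightarrow> (\<forall>n\<ge>1. a (n + r) = a n)"

abbreviation list_product :: "('a, 'b) monoid_scheme \<Rightarrow> 'a list \<Rightarrow> 'a" where
  "list_product G xs \<equiv> foldr (\<otimes>\<^bsub>G\<^esub>) xs \<one>\<^bsub>G\<^esub>"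

definition prefix_order :: "('a, 'b) monoid_scheme \<Rightarrow> 'a set \<Rightarrow> 'a gorder" where
  "prefix_order G P =
     \<lparr>carrier = carrier G, eq = (=), le = (\<lambda>a b. inv\<^bsub>G\<^esub> a \<otimes>\<^bsub>G\<^esub> b \<in> P)\<rparr>"

definition simple_elements :: "('a, 'b) monoid_scheme \<Rightarrow> 'a set \<Rightarrow> 'a \<Rightarrow> 'a set" where
  "simple_elements G P \<Delta> =
     {s \<in> carrier G. \<one>\<^bsub>G\<^esub> \<sqsubseteq>\<^bsub>prefix_order G P\<^esub> s \<and> s \<sqsubseteq>\<^bsub>prefix_order G P\<^esub> \<Delta>}"

text \<open>The set P is the positive monoid (written with a superscript plus on paper).
  The group is generated by P as a group, whereas P is generated by the simple elements as a
  monoid, that is, P is the least submonoid containing them.\<close>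

locale garside_structure = group G for G (structure) +
  fixes P :: "'a set" and \<Delta> :: 'a
  assumes positive_submonoid: "submonoid P G"
    and positive_Int_inverse: "P \<inter> set_inv P = {\<one>}"
    and Garside_positive: "\<Delta> \<in> P"
    and positive_generates: "generate G P = carrier G"
    and atomic: "\<And>g. g \<in> P \<Longrightarrow>
      \<exists>N. \<forall>xs. set xs \<subseteq> P - {\<one>} \<longrightarrow> list_product G xs = g \<longrightarrow> length xs \<le> N"
    and prefix_lattice: "lattice (prefix_order G P)"
    and Garside_conjugation: "(\<lambda>x. inv \<Delta> \<otimes> x \<otimes> \<Delta>) ` P = P"
    and finite_simple: "finite (simple_elements G P \<Delta>)"
    and simple_generate: "\<Inter>{H. submonoid H G \<and> simple_elements G P \<Delta> \<subseteq> H} = P"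
begin

definition tau :: "'a \<Rightarrow> 'a" where
  "tau x = inv \<Delta> \<otimes> x \<otimes> \<Delta>"

text \<open>The iterates of \<^term>\<open>tau\<close> with integer exponent; negative exponents iterate the inverse.\<close>

definition tau_power :: "int \<Rightarrow> 'a \<Rightarrow> 'a" where
  "tau_power k x = \<Delta> [^] (- k) \<otimes> x \<otimes> \<Delta> [^] k"

lemma Garside_closed: "\<Delta> \<in> carrier G"
  using Garside_positive positive_submonoid submonoid.subset by blast

lemma tau_power_0: "x \<in> carrier G \<Longrightarrow> tau_power 0 x = x"
  by (simp add: tau_power_def)

lemma tau_power_Suc:
  assumes "x \<in> carrier G"
  shows "tau_power (k + 1) x = tau (tau_power k x)"
proof -
  have "\<Delta> [^] (- (k + 1)) = inv \<Delta> \<otimes> \<Delta> [^] (- k)"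
    using int_pow_mult[OF Garside_closed, of "- 1" "- k"] Garside_closed
    by (simp add: int_pow_neg algebra_simps)
  moreover have "\<Delta> [^] (k + 1) = \<Delta> [^] k \<otimes> \<Delta>"
    using int_pow_mult[OF Garside_closed, of k 1] Garside_closed by simp
  ultimately show ?thesis
    using assms Garside_closed by (simp add: tau_power_def tau_def m_assoc)
qed

definition complement :: "'a \<Rightarrow> 'a" where
  "complement s = inv s \<otimes> \<Delta>"

definition left_weighted :: "'a \<Rightarrow> 'a \<Rightarrow> bool" where
  "left_weighted s t \<longleftrightarrow>
     s \<in> simple_elements G P \<Delta> \<and> t \<in> simple_elements G P \<Delta> \<and>
     t \<sqinter>\<^bsub>prefix_order G P\<^esub> complement s = \<one>"

definition is_normal_form :: "'a \<Rightarrow> int \<Rightarrow> 'a list \<Rightarrow> bool" where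
  "is_normal_form x p xs \<longleftrightarrow>
     x = \<Delta> [^] p \<otimes> list_product G xs \<and>
     set xs \<subseteq> simple_elements G P \<Delta> - {\<one>, \<Delta>} \<and>
     (\<forall>i. Suc i < length xs \<longrightarrow> left_weighted (xs ! i) (xs ! Suc i))"

definition normal_form :: "'a \<Rightarrow> int \<times> 'a list" where
  "normal_form x = (THE (p, xs). is_normal_form x p xs)"

text \<open>The next two are meaningful only if the list of factors in the normal form is
  nonempty, that is, if the element is not a power of \<^term>\<open>\<Delta>\<close>.\<close>

definition initial_factor :: "'a \<Rightarrow> 'a" where
  "initial_factor x = (case normal_form x of (p, xs) \<Rightarrow> tau_power (- p) (hd xs))"

definition final_factor :: "'a \<Rightarrow> 'a" where
  "final_factor x = last (snd (normal_form x))"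

definition rigid :: "'a \<Rightarrow> bool" where
  "rigid x \<longleftrightarrow> x \<in> carrier G \<and>
     ((\<exists>p::int. x = \<Delta> [^] p) \<or> left_weighted (final_factor x) (initial_factor x))"

definition has_rigid_power :: "'a \<Rightarrow> bool" where
  "has_rigid_power y \<longleftrightarrow> (\<exists>k::nat. 1 \<le> k \<and> rigid (y [^] k))"

definition rigidity_exponent :: "'a \<Rightarrow> nat" where
  "rigidity_exponent y = (LEAST k::nat. 1 \<le> k \<and> rigid (y [^] k))"

definition SC :: "'a \<Rightarrow> 'a set" where
  "SC x = {y. rigid y \<and> conjugate G x y}"

end

end

theory Submission
  imports Defs
begin

text \<open>The normal form of a power of a rigid element is the concatenation of suitably twisted copies of
  its own normal form. Hence a rigid element is determined by any of its positive powers, and if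
  two powers of y are rigid, comparing their normal forms with that of a common power shows that
  their quotient is rigid as well. By the Euclidean algorithm, the exponents n for which y to the
  n is rigid are then exactly the multiples of r(y).

  Let x be rigid and let N be a common multiple of all numbers up to the bound on r. Every rigid
  conjugate of x to the n is the n-th power of a conjugate y of x, and r(y) divides both n and N.
  With d = gcd(n, N), raising to the power n/d is therefore a bijection from the rigid conjugates
  of the d-th power of x to those of the n-th power, and d has period N in n.\<close>

context garside_structure
begin

section \<open>The positive monoid, the prefix order and meets\<close>

abbreviation prefix_le :: "'a \<Rightarrow> 'a \<Rightarrow> bool" (infix "\<preceq>" 50)
  where "a \<preceq> b \<equiv> inv a \<otimes> b \<in> P"

abbreviation simples :: "'a set"
  where "simples \<equiv> simple_elements G P \<Delta>"

lemma positive_closed: "a \<in> P \<Longrightarrow> a \<in> carrier G"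
  using positive_submonoid submonoid.subset by blast

lemma one_positive: "\<one> \<in> P"
  by (rule submonoid.one_closed[OF positive_submonoid])

lemma positive_mult: "a \<in> P \<Longrightarrow> b \<in> P \<Longrightarrow> a \<otimes> b \<in> P"
  using submonoid.m_closed[OF positive_submonoid] by simp

lemma positive_pow: "a \<in> P \<Longrightarrow> a [^] (n::nat) \<in> P"
  by (induction n) (auto simp: one_positive positive_mult)

lemma positive_inverse_trivial:
  assumes "a \<in> P" "inv a \<in> P"
  shows "a = \<one>"
proof -
  have "a \<in> set_inv P"
    using assms positive_closed by (force simp: SET_INV_def)
  then show ?thesis
    using positive_Int_inverse assms(1) by blast
qed

lemma prefix_antisym:
  assumes "a \<in> carrier G" "b \<in> carrier G" "a \<preceq> b" "b \<preceq> a"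
  shows "a = b"
proof -
  have "inv (inv a \<otimes> b) = inv b \<otimes> a"
    using assms(1,2) by (simp add: inv_mult_group)
  then have "inv a \<otimes> b = \<one>"
    using positive_inverse_trivial assms by metis
  then show ?thesis
    using assms(1,2) by (metis inv_closed inv_equality inv_inv)
qed

lemma prefix_trans:
  assumes "a \<in> carrier G" "b \<in> carrier G" "c \<in> carrier G" "a \<preceq> b" "b \<preceq> c"
  shows "a \<preceq> c"
proof -
  have "(inv a \<otimes> b) \<otimes> (inv b \<otimes> c) = inv a \<otimes> c"
    using assms(1-3) by (metis inv_closed m_assoc m_closed r_inv r_one)
  then show ?thesis
    using positive_mult assms by metis
qed

lemma prefix_translate:
  assumes "g \<in> carrier G" "a \<in> carrier G" "b \<in> carrier G"
  shows "g \<otimes> a \<preceq> b \<longleftrightarrow> a \<preceq> inv g \<otimes> b"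
  using assms by (simp add: inv_mult_group m_assoc)

lemma prefix_translate':
  assumes "g \<in> carrier G" "a \<in> carrier G" "b \<in> carrier G"
  shows "inv g \<otimes> a \<preceq> b \<longleftrightarrow> a \<preceq> g \<otimes> b"
  using assms by (simp add: inv_mult_group m_assoc)

lemma inv_mult_cancel: "g \<in> carrier G \<Longrightarrow> a \<in> carrier G \<Longrightarrow> inv g \<otimes> (g \<otimes> a) = a"
  by (metis inv_closed l_inv l_one m_assoc)

lemma mult_inv_cancel: "g \<in> carrier G \<Longrightarrow> a \<in> carrier G \<Longrightarrow> g \<otimes> (inv g \<otimes> a) = a"
  by (metis inv_closed r_inv l_one m_assoc)

lemma prefix_mult: "a \<in> carrier G \<Longrightarrow> b \<in> P \<Longrightarrow> a \<preceq> a \<otimes> b"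
  using inv_mult_cancel positive_closed by metis

lemma prefix_one_trivial: "a \<in> P \<Longrightarrow> a \<preceq> \<one> \<Longrightarrow> a = \<one>"
  using positive_inverse_trivial positive_closed by simp

lemma simple_iff: "s \<in> simples \<longleftrightarrow> s \<in> P \<and> s \<preceq> \<Delta>"
  by (auto simp: simple_elements_def prefix_order_def positive_closed)

text \<open>Unpacks the lattice \<open>prefix_order G P\<close> into the universal property of the
  meet, stated with the bare relation \<open>\<preceq>\<close>. The last clause keeps the link to
  the meet in \<open>left_weighted\<close>.\<close>

lemma ex_meet:
  assumes "a \<in> carrier G" "b \<in> carrier G"
  obtains m where "m \<in> carrier G" "m \<preceq> a" "m \<preceq> b"
    "\<And>u. u \<in> carrier G \<Longrightarrow> u \<preceq> a \<Longrightarrow> u \<preceq> b \<Longrightarrow> u \<preceq> m"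
    "m = a \<sqinter>\<^bsub>prefix_order G P\<^esub> b"
proof -
  interpret L: lattice "prefix_order G P"
    by (rule prefix_lattice)
  show thesis
  proof (rule that[of "a \<sqinter>\<^bsub>prefix_order G P\<^esub> b"])
  qed (use assms L.meet_closed[of a b] L.meet_left[of a b] L.meet_right[of a b] L.meet_le[of _ a b] in
      \<open>auto simp: prefix_order_def\<close>)
qed

section \<open>Conjugation by powers of \<Delta>\<close>

lemma tau_power_closed [simp]: "a \<in> carrier G \<Longrightarrow> tau_power k a \<in> carrier G"
  by (simp add: tau_power_def Garside_closed)

lemma tau_power_mult:
  assumes "a \<in> carrier G" "b \<in> carrier G"
  shows "tau_power k (a \<otimes> b) = tau_power k a \<otimes> tau_power k b"
  using assms Garside_closed by (simp add: tau_power_def m_assoc int_pow_neg mult_inv_cancel)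

lemma tau_power_one [simp]: "tau_power k \<one> = \<one>"
  using Garside_closed by (simp add: tau_power_def int_pow_neg)

lemma tau_power_Garside [simp]: "tau_power k \<Delta> = \<Delta>"
proof -
  have "\<Delta> \<otimes> \<Delta> [^] k = \<Delta> [^] k \<otimes> \<Delta>"
    using int_pow_mult[OF Garside_closed, of 1 k] int_pow_mult[OF Garside_closed, of k 1]
      Garside_closed by (simp add: add.commute)
  then show ?thesis
    using Garside_closed by (simp add: tau_power_def int_pow_neg m_assoc inv_mult_cancel)
qed

lemma tau_power_inv:
  assumes "a \<in> carrier G"
  shows "tau_power k (inv a) = inv (tau_power k a)"
  using assms by (metis inv_closed inv_equality l_inv tau_power_closed tau_power_mult tau_power_one)

lemma tau_power_add:
  assumes "a \<in> carrier G"
  shows "tau_power j (tau_power k a) = tau_power (j + k) a"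
proof -
  have "\<Delta> [^] (- (j + k)) = \<Delta> [^] (- j) \<otimes> \<Delta> [^] (- k)"
    using int_pow_mult[OF Garside_closed, of "- j" "- k"] by (simp add: algebra_simps)
  moreover have "\<Delta> [^] (j + k) = \<Delta> [^] k \<otimes> \<Delta> [^] j"
    using int_pow_mult[OF Garside_closed, of k j] by (simp add: add.commute)
  ultimately show ?thesis
    using assms Garside_closed by (simp add: tau_power_def m_assoc)
qed

text \<open>Collecting powers of \<Delta> on the left twists whatever they pass; this is how twists
  enter the normal form of a power.\<close>

lemma mult_Garside_pow:
  assumes "a \<in> carrier G"
  shows "a \<otimes> \<Delta> [^] (k::int) = \<Delta> [^] k \<otimes> tau_power k a"
  using assms Garside_closed
  by (simp add: tau_power_def int_pow_neg m_assoc mult_inv_cancel)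

lemma tau_positive: "tau ` P = P"
  using Garside_conjugation by (simp add: tau_def[abs_def])

lemma tau_power_positive:
  assumes "a \<in> P"
  shows "tau_power k a \<in> P"
proof (induction k rule: int_induct[where k = 0])
  case base
  then show ?case
    using assms by (simp add: tau_power_0 positive_closed)
next
  case (step1 i)
  then show ?case
    using assms tau_positive by (auto simp: tau_power_Suc positive_closed)
next
  case (step2 i)
  \<comment> \<open>Stepping down uses that \<open>tau\<close> maps P onto P: the positive preimage
    b found this way equals \<open>tau_power (i - 1) a\<close>, since a twist can be undone.\<close>
  have "tau_power 1 (tau_power (i - 1) a) \<in> tau ` P"
    using step2 assms tau_positive by (simp add: tau_power_add positive_closed)
  then obtain b where b: "b \<in> P" "tau_power 1 (tau_power (i - 1) a) = tau b"
    by blast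
  have "tau b = tau_power 1 b"
    using b(1) tau_power_Suc[of b 0] tau_power_0 positive_closed by simp
  then have "tau_power (- 1) (tau_power 1 (tau_power (i - 1) a)) = tau_power (- 1) (tau_power 1 b)"
    using b(2) by simp
  then have "tau_power (i - 1) a = b"
    using assms b(1) positive_closed by (simp add: tau_power_add tau_power_0)
  then show ?case
    using b(1) by simp
qed

lemma tau_power_inj:
  assumes "a \<in> carrier G" "b \<in> carrier G" "tau_power k a = tau_power k b"
  shows "a = b"
proof -
  have "tau_power (- k) (tau_power k a) = tau_power (- k) (tau_power k b)"
    using assms(3) by simp
  then show ?thesis
    using assms(1,2) by (simp add: tau_power_add tau_power_0)
qed

lemma tau_power_simple: "s \<in> simples \<Longrightarrow> tau_power k s \<in> simples"
  unfolding simple_iff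
  using tau_power_positive[of s k] tau_power_positive[of "inv s \<otimes> \<Delta>" k]
  by (simp add: tau_power_mult tau_power_inv positive_closed Garside_closed)

section \<open>Complements and left-weighted pairs\<close>

lemma simple_complement:
  assumes "s \<in> simples"
  shows "complement s \<in> simples"
proof -
  have s: "s \<in> P" "s \<in> carrier G"
    using assms by (auto simp: simple_iff positive_closed)
  \<comment> \<open>The complement of the complement of s is the twist of s by \<open>tau\<close>,
    which is positive.\<close>
  have "inv (complement s) \<otimes> \<Delta> = tau_power 1 s"
    using s Garside_closed
    by (simp add: complement_def tau_power_def int_pow_neg inv_mult_group m_assoc)
  then show ?thesis
    using assms s tau_power_positive by (simp add: simple_iff complement_def)
qed

lemma simple_closed: "s \<in> simples \<Longrightarrow> s \<in> carrier G"
  by (simp add: simple_iff positive_closed)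

text \<open>Since t and the complement of s are positive, 1 lies below both, so their meet is
  positive; it is 1 exactly when every positive common prefix is 1.\<close>

lemma left_weighted_iff:
  "left_weighted s t \<longleftrightarrow> s \<in> simples \<and> t \<in> simples \<and>
     (\<forall>u\<in>P. u \<preceq> t \<longrightarrow> u \<preceq> complement s \<longrightarrow> u = \<one>)"
proof (cases "s \<in> simples \<and> t \<in> simples")
  case True
  then have cl: "t \<in> carrier G" "complement s \<in> carrier G" "t \<in> P" "complement s \<in> P"
    using simple_complement by (auto simp: simple_iff positive_closed)
  obtain m where m: "m \<in> carrier G" "m \<preceq> t" "m \<preceq> complement s"
    "\<And>u. u \<in> carrier G \<Longrightarrow> u \<preceq> t \<Longrightarrow> u \<preceq> complement s \<Longrightarrow> u \<preceq> m"
    "m = t \<sqinter>\<^bsub>prefix_order G P\<^esub> complement s"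
    using ex_meet[OF cl(1,2)] by blast
  have "m \<in> P"
    using m(4)[of \<one>] m(1) cl by simp
  then show ?thesis
    using True m positive_closed prefix_one_trivial unfolding left_weighted_def by metis
qed (auto simp: left_weighted_def)

text \<open>Twisting is an automorphism that preserves P and fixes \<Delta>, so it commutes with
  complements; common prefixes are pulled back by the inverse twist.\<close>

lemma left_weighted_tau_power:
  assumes "left_weighted s t"
  shows "left_weighted (tau_power k s) (tau_power k t)"
proof -
  have st: "s \<in> simples" "t \<in> simples" "s \<in> carrier G" "t \<in> carrier G"
    using assms by (auto simp: left_weighted_iff simple_closed)
  have compl: "complement (tau_power k s) = tau_power k (complement s)"
    using st Garside_closed by (simp add: complement_def tau_power_mult tau_power_inv)
  have cs: "complement s \<in> carrier G"
    using st simple_complement simple_closed by blast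
  have "u = \<one>" if u: "u \<in> P" "u \<preceq> tau_power k t" "u \<preceq> complement (tau_power k s)" for u
  proof -
    have transfer: "tau_power (- k) u \<preceq> a" if "u \<preceq> tau_power k a" "a \<in> carrier G" for a
      using tau_power_positive[OF that(1), of "- k"] that(2) u(1)
      by (simp add: tau_power_mult tau_power_inv positive_closed tau_power_add tau_power_0)
    have "tau_power (- k) u = \<one>"
      using assms transfer[of t] transfer[of "complement s"] u st cs compl tau_power_positive
      by (simp add: left_weighted_iff)
    then show ?thesis
      using u(1) tau_power_inj[of u \<one> "- k"] positive_closed by simp
  qed
  then show ?thesis
    using st tau_power_simple by (simp add: left_weighted_iff)
qed

section \<open>Products of factor lists and uniqueness of normal forms\<close>

lemma list_product_closed: "set xs \<subseteq> carrier G \<Longrightarrow> list_product G xs \<in> carrier G"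
  by (induction xs) auto

lemma list_product_positive: "set xs \<subseteq> P \<Longrightarrow> list_product G xs \<in> P"
  by (induction xs) (auto simp: one_positive positive_mult)

lemma list_product_append:
  "set xs \<subseteq> carrier G \<Longrightarrow> set ys \<subseteq> carrier G \<Longrightarrow>
    list_product G (xs @ ys) = list_product G xs \<otimes> list_product G ys"
  by (induction xs) (auto simp: m_assoc list_product_closed)

lemma tau_power_list_product:
  "set xs \<subseteq> carrier G \<Longrightarrow> tau_power k (list_product G xs) = list_product G (map (tau_power k) xs)"
  by (induction xs) (auto simp: tau_power_mult list_product_closed)

text \<open>The factor part of a normal form, detached from the power of \<Delta>. Adjacency is
  phrased by \<open>successively\<close> instead of indices, which suits induction and
  concatenation.\<close>

definition normal_list :: "'a list \<Rightarrow> bool" where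
  "normal_list xs \<longleftrightarrow> set xs \<subseteq> simples - {\<one>, \<Delta>} \<and> successively left_weighted xs"

lemma is_normal_form_iff:
  "is_normal_form x p xs \<longleftrightarrow> x = \<Delta> [^] p \<otimes> list_product G xs \<and> normal_list xs"
  by (auto simp: is_normal_form_def normal_list_def successively_conv_nth)

lemma normal_list_positive: "normal_list xs \<Longrightarrow> set xs \<subseteq> P"
  by (auto simp: normal_list_def simple_iff)

lemma normal_list_carrier: "normal_list xs \<Longrightarrow> set xs \<subseteq> carrier G"
  using normal_list_positive positive_closed by blast

lemma normal_list_append:
  "normal_list (xs @ ys) \<longleftrightarrow> normal_list xs \<and> normal_list ys \<and>
     (xs \<noteq> [] \<longrightarrow> ys \<noteq> [] \<longrightarrow> left_weighted (last xs) (hd ys))"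
  by (auto simp: normal_list_def successively_append_iff)

lemma normal_list_Cons:
  "normal_list (x # xs) \<longleftrightarrow> x \<in> simples - {\<one>, \<Delta>} \<and> normal_list xs \<and>
     (xs \<noteq> [] \<longrightarrow> left_weighted x (hd xs))"
  by (cases xs) (auto simp: normal_list_def)

lemma normal_list_tau_power:
  assumes "normal_list xs"
  shows "normal_list (map (tau_power k) xs)"
  using assms
proof (induction xs)
  case (Cons x xs)
  have "x \<in> carrier G"
    using Cons.prems by (simp add: normal_list_Cons simple_closed)
  then have "tau_power k x \<noteq> \<one>" "tau_power k x \<noteq> \<Delta>"
    using Cons.prems tau_power_inj[of x \<one> k] tau_power_inj[of x \<Delta> k] Garside_closed
    by (auto simp: normal_list_Cons)
  then show ?case
    using Cons left_weighted_tau_power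
    by (auto simp: normal_list_Cons tau_power_simple hd_map)
qed simp

text \<open>If the product is s g with first factor s, and m is its meet with \<^term>\<open>\<Delta>\<close>, then the quotient of
  m by s is a common prefix of g and the complement of s, so left-weightedness forces m = s.\<close>

lemma normal_list_head_greatest:
  assumes "normal_list xs" "u \<in> carrier G" "u \<preceq> list_product G xs" "u \<preceq> \<Delta>"
  shows "u \<preceq> (if xs = [] then \<one> else hd xs)"
  using assms
proof (induction xs arbitrary: u)
  case (Cons s xs)
  define g where "g = list_product G xs"
  have s: "s \<in> simples" "s \<in> P" "s \<in> carrier G" "s \<preceq> \<Delta>"
    using Cons.prems(1) by (auto simp: normal_list_Cons simple_iff positive_closed)
  have xs: "normal_list xs"
    using Cons.prems(1) by (simp add: normal_list_Cons)
  have g: "g \<in> P" "g \<in> carrier G"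
    using normal_list_positive[OF xs] list_product_positive positive_closed by (auto simp: g_def)
  obtain m where m: "m \<in> carrier G" "m \<preceq> s \<otimes> g" "m \<preceq> \<Delta>"
    "\<And>u. u \<in> carrier G \<Longrightarrow> u \<preceq> s \<otimes> g \<Longrightarrow> u \<preceq> \<Delta> \<Longrightarrow> u \<preceq> m"
    using ex_meet[OF m_closed[OF s(3) g(2)] Garside_closed] by blast
  define v where "v = inv s \<otimes> m"
  have v: "v \<in> carrier G"
    using s m by (simp add: v_def)
  have "v \<in> P"
    unfolding v_def using m(4)[of s] s g prefix_mult by simp
  have "v \<preceq> g"
    unfolding v_def using m s g by (simp add: prefix_translate')
  have vc: "v \<preceq> complement s"
    unfolding v_def complement_def using m s Garside_closed
    by (simp add: prefix_translate' mult_inv_cancel)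
  have c: "complement s \<in> simples"
    using s(1) by (rule simple_complement)
  \<comment> \<open>With v below \<Delta>, the induction hypothesis bounds v by the head of xs, or
    by 1 if xs is empty.\<close>
  then have "v \<preceq> \<Delta>"
    using prefix_trans[OF v _ Garside_closed vc] by (simp add: simple_iff positive_closed)
  then have vh: "v \<preceq> (if xs = [] then \<one> else hd xs)"
    using Cons.IH[OF xs v] \<open>v \<preceq> g\<close> by (simp add: g_def)
  have "v = \<one>"
  proof (cases "xs = []")
    case True
    then show ?thesis
      using vh \<open>v \<in> P\<close> prefix_one_trivial by simp
  next
    case False
    then have "left_weighted s (hd xs)"
      using Cons.prems(1) by (simp add: normal_list_Cons)
    then show ?thesis
      using vh vc \<open>v \<in> P\<close> False by (simp add: left_weighted_iff)
  qed
  then have "m = s"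
    using s m unfolding v_def by (metis inv_closed inv_equality inv_inv)
  then show ?case
    using m(4) Cons.prems by (simp add: g_def)
qed simp

text \<open>Each head is the greatest common prefix of \<Delta> and the product, so the heads of two
  lists with equal product are prefixes of each other and coincide; cancel them and induct.\<close>

lemma normal_list_unique:
  assumes "normal_list xs" "normal_list ys" "list_product G xs = list_product G ys"
  shows "xs = ys"
  using assms
proof (induction xs arbitrary: ys)
  \<comment> \<open>A nonempty normal list cannot have product 1, because its first factor is a
    nontrivial positive prefix of the product.\<close>
  have head: "\<not> (list_product G xs = list_product G ys \<and> xs \<noteq> [] \<and> ys = [])"
    if "normal_list xs" "normal_list ys" for xs ys
  proof
    assume *: "list_product G xs = list_product G ys \<and> xs \<noteq> [] \<and> ys = []"
    then obtain x zs where xs: "xs = x # zs"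
      by (cases xs) auto
    have x: "x \<in> P" "x \<noteq> \<one>"
      using that by (auto simp: xs normal_list_Cons simple_iff)
    have "x \<preceq> x \<otimes> list_product G zs"
      using that x prefix_mult list_product_positive normal_list_positive positive_closed
      by (simp add: xs normal_list_Cons)
    then have "x \<preceq> \<one>"
      using * by (simp add: xs)
    then show False
      using x prefix_one_trivial by simp
  qed
  {
    case Nil
    then show ?case
      using head[of ys "[]"] by auto
  next
    case (Cons x xs)
    then obtain y zs where ys: "ys = y # zs"
      using head[of "x # xs" ys] by (cases ys) auto
    have xy: "x \<in> simples" "y \<in> simples" "x \<in> carrier G" "y \<in> carrier G"
      using Cons.prems by (auto simp: ys normal_list_Cons simple_closed)
    have nl: "normal_list xs" "normal_list zs"
      using Cons.prems by (auto simp: ys normal_list_Cons)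
    have pr: "list_product G xs \<in> P" "list_product G zs \<in> P"
      using nl by (auto intro: list_product_positive dest: normal_list_positive)
    have "x \<preceq> y"
      using normal_list_head_greatest[OF Cons.prems(2) xy(3)] prefix_mult[OF xy(3) pr(1)]
        Cons.prems(3) xy(1) by (simp add: ys simple_iff)
    moreover have "y \<preceq> x"
      using normal_list_head_greatest[OF Cons.prems(1) xy(4)] prefix_mult[OF xy(4) pr(2)]
        Cons.prems(3) xy(2) by (simp add: ys simple_iff)
    ultimately have "x = y"
      using xy prefix_antisym by blast
    then show ?case
      using Cons.IH[OF nl] Cons.prems(3) xy pr by (simp add: ys positive_closed)
  }
qed

text \<open>Otherwise \<Delta> would be a prefix of the first factor, which is a prefix of \<Delta>
  different from \<Delta>, or of 1 if the list is empty.\<close>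

lemma normal_list_not_Garside_prefix:
  assumes "normal_list xs" "\<Delta> \<noteq> \<one>"
  shows "\<not> \<Delta> \<preceq> list_product G xs"
proof
  assume *: "\<Delta> \<preceq> list_product G xs"
  have "\<Delta> \<preceq> (if xs = [] then \<one> else hd xs)"
    using normal_list_head_greatest[OF assms(1) Garside_closed *] Garside_closed one_positive by simp
  moreover have "\<Delta> \<noteq> hd xs \<and> hd xs \<preceq> \<Delta> \<and> hd xs \<in> carrier G" if "xs \<noteq> []"
    using assms(1) that by (cases xs) (auto simp: normal_list_Cons simple_iff positive_closed)
  ultimately show False
    using assms(2) prefix_antisym[OF Garside_closed, of "hd xs"]
      prefix_one_trivial[OF Garside_positive] by (auto split: if_splits)
qed

text \<open>If q exceeded p, cancelling the common power would leave at least one \<Delta> in front,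
  making \<Delta> a prefix of the product of xs. Used in both directions, this gives equal
  exponents.\<close>

lemma normal_form_exponent_le:
  assumes "is_normal_form x p xs" "is_normal_form x q ys" "\<Delta> \<noteq> \<one>"
  shows "q \<le> p"
proof (rule ccontr)
  assume "\<not> q \<le> p"
  then obtain n where n: "q = p + 1 + int n"
    by (metis add.assoc not_le of_nat_Suc zless_iff_Suc_zadd)
  have nl: "normal_list xs" "normal_list ys"
    using assms by (auto simp: is_normal_form_iff)
  have pr: "list_product G xs \<in> carrier G" "list_product G ys \<in> P"
    using nl by (auto intro: list_product_positive list_product_closed
        dest: normal_list_positive normal_list_carrier)
  have "\<Delta> [^] q = \<Delta> [^] p \<otimes> (\<Delta> \<otimes> \<Delta> [^] n)"
    using int_pow_mult[OF Garside_closed, of "p + 1" "int n"] int_pow_mult[OF Garside_closed, of p 1]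
      Garside_closed by (simp add: n int_pow_int m_assoc)
  then have "list_product G xs = \<Delta> \<otimes> (\<Delta> [^] n \<otimes> list_product G ys)"
    using assms(1,2) pr Garside_closed positive_closed by (simp add: is_normal_form_iff m_assoc)
  then have "\<Delta> \<preceq> list_product G xs"
    using prefix_mult[OF Garside_closed] pr(2) Garside_positive positive_pow positive_mult by simp
  then show False
    using normal_list_not_Garside_prefix nl(1) assms(3) by blast
qed

text \<open>The only simple element is then 1, which is excluded as a factor.\<close>

lemma normal_form_trivial_Garside:
  assumes "is_normal_form x p xs" "\<Delta> = \<one>"
  shows "xs = []"
proof -
  have "s = \<one>" if "s \<in> simples" for s
    using that prefix_one_trivial[of s] assms(2) simple_iff[of s] by simp
  then show ?thesis
    using assms(1) by (cases xs) (auto simp: is_normal_form_def)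
qed

text \<open>If \<^term>\<open>\<Delta> = \<one>\<close>, then the group is trivial and every exponent occurs.\<close>

lemma normal_form_unique:
  assumes "is_normal_form x p xs" "is_normal_form x q ys"
  shows "xs = ys \<and> (\<Delta> \<noteq> \<one> \<longrightarrow> p = q)"
proof (cases "\<Delta> = \<one>")
  case True
  then show ?thesis
    using assms normal_form_trivial_Garside by blast
next
  case False
  then have "p = q"
    using normal_form_exponent_le assms by (meson antisym)
  then show ?thesis
    using assms normal_list_unique[of xs ys] Garside_closed
    by (auto simp: is_normal_form_iff list_product_closed normal_list_carrier)
qed

section \<open>Existence of normal forms\<close>

lemma positive_induct_submonoid:
  assumes "submonoid H G" "simples \<subseteq> H"
  shows "P \<subseteq> H"
  using simple_generate assms by blast

text \<open>Guarantees that a nontrivial positive element has a nontrivial meet with \<Delta>. The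
  property passes to products, as a prefix of a is a prefix of ab, and a simple element is a prefix
  of itself.\<close>

lemma ex_simple_prefix:
  assumes "g \<in> P" "g \<noteq> \<one>"
  shows "\<exists>s\<in>simples. s \<noteq> \<one> \<and> s \<preceq> g"
proof -
  let ?H = "{g \<in> P. g \<noteq> \<one> \<longrightarrow> (\<exists>s\<in>simples. s \<noteq> \<one> \<and> s \<preceq> g)}"
  have "submonoid ?H G"
  proof
    fix a b assume "a \<in> ?H" "b \<in> ?H"
    then have ab: "a \<in> P" "b \<in> P" "a \<in> carrier G" "b \<in> carrier G"
      by (auto simp: positive_closed)
    show "a \<otimes> b \<in> ?H"
    proof (cases "a = \<one>")
      case False
      then obtain s where s: "s \<in> simples" "s \<noteq> \<one>" "s \<preceq> a"
        using \<open>a \<in> ?H\<close> by blast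
      have "s \<preceq> a \<otimes> b"
        using prefix_trans[of s a "a \<otimes> b"] s ab prefix_mult simple_closed by simp
      then show ?thesis
        using s ab positive_mult by blast
    qed (use \<open>b \<in> ?H\<close> ab in auto)
  qed (auto simp: one_positive positive_closed)
  moreover have "simples \<subseteq> ?H"
    using one_positive by (force simp: simple_iff positive_closed)
  ultimately show ?thesis
    using positive_induct_submonoid assms by blast
qed

text \<open>Greedy decomposition: split off the meet s of g with \<Delta> and recurse on the rest h.
  If s is \<Delta>, the exponent grows; otherwise s becomes the new first factor. Atomicity makes
  this terminate.\<close>

lemma ex_normal_form_positive:
  assumes "g \<in> P"
  shows "\<exists>(n::nat) xs. is_normal_form g (int n) xs"
proof -
  have *: "\<exists>(n::nat) xs. is_normal_form g (int n) xs"
    if "g \<in> P" "\<forall>xs. set xs \<subseteq> P - {\<one>} \<longrightarrow> list_product G xs = g \<longrightarrow> length xs \<le> N" for N g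
    using that
  proof (induction N arbitrary: g)
    case 0
    have "g = \<one>"
    proof (rule ccontr)
      assume "g \<noteq> \<one>"
      then show False
        using 0(2)[rule_format, of "[g]"] 0(1) positive_closed by simp
    qed
    then show ?case
      by (intro exI[of _ 0] exI[of _ "[]"]) (simp add: is_normal_form_def)
  next
    case (Suc N)
    show ?case
    proof (cases "g = \<one>")
      case True
      then show ?thesis
        by (intro exI[of _ 0] exI[of _ "[]"]) (simp add: is_normal_form_def)
    next
      case False
      have g: "g \<in> carrier G"
        using Suc.prems positive_closed by simp
      obtain s where s: "s \<in> carrier G" "s \<preceq> g" "s \<preceq> \<Delta>"
        "\<And>u. u \<in> carrier G \<Longrightarrow> u \<preceq> g \<Longrightarrow> u \<preceq> \<Delta> \<Longrightarrow> u \<preceq> s"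
        using ex_meet[OF g Garside_closed] by blast
      have sP: "s \<in> P"
        using s(4)[of \<one>] s(1) Garside_positive Garside_closed Suc.prems(1) g by simp
      have ss: "s \<in> simples"
        using s sP by (simp add: simple_iff)
      have "s \<noteq> \<one>"
        using ex_simple_prefix[OF Suc.prems(1) False] s(4) prefix_one_trivial
        by (metis simple_iff positive_closed)
      define h where "h = inv s \<otimes> g"
      have h: "h \<in> P" "h \<in> carrier G" and g_eq: "g = s \<otimes> h"
        using s g by (auto simp: h_def mult_inv_cancel)
      \<comment> \<open>Prepending s to a factorization of h gives one of g with one more nontrivial
        factor, so the bound drops by one.\<close>
      have "length xs \<le> N" if "set xs \<subseteq> P - {\<one>}" "list_product G xs = h" for xs
        using Suc.prems(2)[rule_format, of "s # xs"] that sP \<open>s \<noteq> \<one>\<close> by (simp add: g_eq)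
      then obtain n xs where nf: "is_normal_form h (int n) xs"
        using Suc.IH h(1) by blast
      then have xs: "normal_list xs" "list_product G xs \<in> P" "list_product G xs \<in> carrier G"
        using list_product_positive normal_list_positive positive_closed
        by (auto simp: is_normal_form_iff)
      show ?thesis
      proof (cases "s = \<Delta>")
        case True
        have "is_normal_form g (int (Suc n)) xs"
          using nf xs g_eq True Garside_closed nat_pow_Suc2[OF Garside_closed, of n]
          by (simp add: is_normal_form_iff int_pow_int m_assoc del: of_nat_Suc nat_pow_Suc)
        then show ?thesis
          by blast
      next
        case False
        \<comment> \<open>A \<Delta> at the front of h could be moved left past s, so \<Delta> would
          be a prefix of g, hence of s, forcing s = \<Delta>.\<close>
        have "n = 0"
        proof (rule ccontr)
          assume "n \<noteq> 0"
          then obtain m where m: "n = Suc m"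
            using not0_implies_Suc by blast
          have hm: "h = \<Delta> \<otimes> (\<Delta> [^] m \<otimes> list_product G xs)"
            using nf xs Garside_closed nat_pow_Suc2[OF Garside_closed, of m] m_assoc[symmetric]
            by (simp add: is_normal_form_iff int_pow_int m del: of_nat_Suc nat_pow_Suc)
          have k: "\<Delta> [^] m \<otimes> list_product G xs \<in> P"
            using xs Garside_positive positive_pow positive_mult by simp
          have "s \<otimes> \<Delta> = \<Delta> \<otimes> tau_power 1 s"
            using mult_Garside_pow[of s 1] s Garside_closed by simp
          then have "g = \<Delta> \<otimes> (tau_power 1 s \<otimes> (\<Delta> [^] m \<otimes> list_product G xs))"
            using g_eq hm s Garside_closed xs k by (metis m_assoc positive_closed tau_power_closed)
          then have "\<Delta> \<preceq> g"
            using k sP tau_power_positive positive_mult prefix_mult[OF Garside_closed] by simp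
          then have "\<Delta> \<preceq> s"
            using s(4)[of \<Delta>] Garside_closed one_positive by simp
          then show False
            using False prefix_antisym[OF Garside_closed s(1)] s(3) by simp
        qed
        then have hx: "h = list_product G xs"
          using nf xs by (simp add: is_normal_form_iff)
        \<comment> \<open>A common prefix u of the next factor and the complement of s makes su a
          common prefix of g and \<Delta>; as s is the greatest one, u is 1.\<close>
        have "left_weighted s (hd xs)" if "xs \<noteq> []"
        proof -
          obtain t ys where ts: "xs = t # ys"
            using \<open>xs \<noteq> []\<close> by (cases xs) auto
          have t: "t \<in> simples" "t \<in> carrier G" "normal_list ys"
            using xs(1) by (auto simp: ts normal_list_Cons simple_closed)
          have "t \<preceq> h"
            using t prefix_mult list_product_positive normal_list_positive by (simp add: hx ts)
          have "u = \<one>" if u: "u \<in> P" "u \<preceq> t" "u \<preceq> complement s" for u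
          proof -
            have "u \<preceq> h"
              using prefix_trans[of u t h] u t h \<open>t \<preceq> h\<close> positive_closed by simp
            then have "s \<otimes> u \<preceq> g"
              using u s g positive_closed by (simp add: prefix_translate h_def)
            moreover have "s \<otimes> u \<preceq> \<Delta>"
              using u s Garside_closed positive_closed by (simp add: prefix_translate complement_def)
            ultimately have "s \<otimes> u \<preceq> s"
              using s(1,4) u(1) positive_closed by simp
            then show ?thesis
              using prefix_one_trivial[OF u(1)] s(1) u(1) positive_closed by (simp add: prefix_translate)
          qed
          then show ?thesis
            using ss t by (simp add: left_weighted_iff ts)
        qed
        then have "normal_list (s # xs)"
          using xs ss False \<open>s \<noteq> \<one>\<close> by (simp add: normal_list_Cons)
        then have "is_normal_form g (int 0) (s # xs)"
          using s(1) xs by (simp add: is_normal_form_iff g_eq hx)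
        then show ?thesis
          by blast
      qed
    qed
  qed
  then show ?thesis
    using atomic[OF assms] assms by blast
qed

text \<open>Reduces existence of normal forms to positive elements. The elements with this property
  are closed under products and include P and the inverses of P, and P generates the group.\<close>

lemma ex_Garside_multiple_positive:
  assumes "x \<in> carrier G"
  shows "\<exists>n::nat. \<Delta> [^] n \<otimes> x \<in> P"
proof -
  let ?D = "{x \<in> carrier G. \<exists>n::nat. \<Delta> [^] n \<otimes> x \<in> P}"
  have mult: "a \<otimes> b \<in> ?D" if D: "a \<in> ?D" "b \<in> ?D" for a b
  proof -
    obtain m n :: nat where mn: "\<Delta> [^] m \<otimes> a \<in> P" "\<Delta> [^] n \<otimes> b \<in> P"
      using D by blast
    have ab: "a \<in> carrier G" "b \<in> carrier G"
      using D by auto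
    \<comment> \<open>Moving the n extra copies of \<Delta> past the positive element made from a
      twists it, which keeps it positive, and delivers them to b.\<close>
    have "\<Delta> [^] n \<otimes> (\<Delta> [^] m \<otimes> a) = tau_power (- int n) (\<Delta> [^] m \<otimes> a) \<otimes> \<Delta> [^] n"
      using ab Garside_closed by (simp add: tau_power_def int_pow_neg int_pow_int m_assoc)
    moreover have "\<Delta> [^] (n + m) \<otimes> (a \<otimes> b) = \<Delta> [^] n \<otimes> (\<Delta> [^] m \<otimes> a) \<otimes> b"
      using ab Garside_closed by (simp add: nat_pow_mult[symmetric] m_assoc)
    ultimately have "\<Delta> [^] (n + m) \<otimes> (a \<otimes> b) =
        tau_power (- int n) (\<Delta> [^] m \<otimes> a) \<otimes> (\<Delta> [^] n \<otimes> b)"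
      using ab Garside_closed by (simp only: m_assoc tau_power_closed m_closed nat_pow_closed)
    then have "\<Delta> [^] (n + m) \<otimes> (a \<otimes> b) \<in> P"
      using mn tau_power_positive positive_mult by simp
    then show ?thesis
      using ab by blast
  qed
  have posD: "P \<subseteq> ?D"
    using positive_closed by (auto intro!: exI[of _ 0])
  \<comment> \<open>Inverses are treated by induction over P: for s simple, multiplying the inverse
    of s by a single \<Delta> gives a twist of the complement of s.\<close>
  have "submonoid {h \<in> P. inv h \<in> ?D} G"
  proof
    fix a b assume "a \<in> {h \<in> P. inv h \<in> ?D}" "b \<in> {h \<in> P. inv h \<in> ?D}"
    then show "a \<otimes> b \<in> {h \<in> P. inv h \<in> ?D}"
      using mult[of "inv b" "inv a"] positive_mult positive_closed by (simp add: inv_mult_group)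
  qed (use one_positive posD in \<open>auto simp: positive_closed\<close>)
  moreover have "simples \<subseteq> {h \<in> P. inv h \<in> ?D}"
  proof
    fix s assume s: "s \<in> simples"
    then have "tau_power (- 1) (complement s) \<in> P"
      using simple_complement simple_iff tau_power_positive by blast
    moreover have "tau_power (- 1) (complement s) = \<Delta> [^] (1::nat) \<otimes> inv s"
      using s Garside_closed simple_closed
      by (simp add: tau_power_def complement_def m_assoc int_pow_neg)
    ultimately have "\<Delta> [^] (1::nat) \<otimes> inv s \<in> P"
      by simp
    then show "s \<in> {h \<in> P. inv h \<in> ?D}"
      using s simple_closed unfolding simple_iff by blast
  qed
  ultimately have inverses: "P \<subseteq> {h \<in> P. inv h \<in> ?D}"
    by (rule positive_induct_submonoid)
  have "x \<in> generate G P"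
    using assms positive_generates by simp
  then have "x \<in> ?D"
  proof (induction rule: generate.induct)
    case one
    then show ?case using posD one_positive by blast
  next
    case (incl h)
    then show ?case using posD by blast
  next
    case (inv h)
    then show ?case using inverses by blast
  next
    case (eng h1 h2)
    then show ?case using mult by blast
  qed
  then show ?thesis
    by blast
qed

lemma ex_normal_form:
  assumes "x \<in> carrier G"
  shows "\<exists>p xs. is_normal_form x p xs"
proof -
  obtain n :: nat where n: "\<Delta> [^] n \<otimes> x \<in> P"
    using ex_Garside_multiple_positive assms by blast
  obtain m xs where nf: "is_normal_form (\<Delta> [^] n \<otimes> x) (int m) xs"
    using ex_normal_form_positive[OF n] by blast
  then have pr: "list_product G xs \<in> carrier G"
    by (simp add: is_normal_form_iff list_product_closed normal_list_carrier)
  have "x = \<Delta> [^] (- int n) \<otimes> (\<Delta> [^] n \<otimes> x)"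
    using assms Garside_closed by (simp add: int_pow_neg int_pow_int inv_mult_cancel)
  also have "\<dots> = \<Delta> [^] (- int n) \<otimes> (\<Delta> [^] int m \<otimes> list_product G xs)"
    using nf by (simp add: is_normal_form_iff)
  also have "\<dots> = \<Delta> [^] (- int n + int m) \<otimes> list_product G xs"
    using pr Garside_closed by (simp only: int_pow_mult m_assoc int_pow_closed)
  finally have "is_normal_form x (- int n + int m) xs"
    using nf by (simp add: is_normal_form_iff)
  then show ?thesis
    by blast
qed

section \<open>Rigid elements and their powers\<close>

definition rigid_form :: "'a \<Rightarrow> int \<Rightarrow> 'a list \<Rightarrow> bool" where
  "rigid_form x p xs \<longleftrightarrow> is_normal_form x p xs \<and>
     (xs \<noteq> [] \<longrightarrow> left_weighted (last xs) (tau_power (- p) (hd xs)))"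

lemma rigid_form_unique:
  "rigid_form x p xs \<Longrightarrow> rigid_form x q ys \<Longrightarrow> xs = ys \<and> (\<Delta> \<noteq> \<one> \<longrightarrow> p = q)"
  by (rule normal_form_unique) (auto simp: rigid_form_def)

lemma normal_form_eq:
  assumes "is_normal_form x p xs" "\<Delta> \<noteq> \<one>"
  shows "normal_form x = (p, xs)"
  unfolding normal_form_def
  by (rule the_equality) (use assms normal_form_unique in auto)

lemma is_normal_form_Garside_pow: "is_normal_form (\<Delta> [^] p) p []"
  using Garside_closed by (simp add: is_normal_form_def)

text \<open>Replaces the definite description in \<open>normal_form\<close> by an explicit witness.
  Powers of \<Delta> are covered by the empty list, for which \<open>rigid_form\<close> imposes no
  closing condition.\<close>

lemma rigid_iff: "rigid x \<longleftrightarrow> (\<exists>p xs. rigid_form x p xs)"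
proof
  assume x: "rigid x"
  show "\<exists>p xs. rigid_form x p xs"
  proof (cases "\<exists>p::int. x = \<Delta> [^] p")
    case True
    then show ?thesis
      using is_normal_form_Garside_pow by (auto simp: rigid_form_def)
  next
    case False
    have "x \<in> carrier G"
      using x by (simp add: rigid_def)
    then obtain p xs where nf: "is_normal_form x p xs"
      using ex_normal_form by blast
    \<comment> \<open>Only for nontrivial \<Delta> is the exponent unique, so that
      \<open>normal_form\<close> really returns the pair at hand.\<close>
    have "\<Delta> \<noteq> \<one>"
    proof
      assume "\<Delta> = \<one>"
      then have "xs = []"
        using nf normal_form_trivial_Garside by blast
      then show False
        using nf False Garside_closed by (auto simp: is_normal_form_def)
    qed
    then have "rigid_form x p xs"
      using x False nf normal_form_eq[OF nf]
      by (auto simp: rigid_def rigid_form_def final_factor_def initial_factor_def)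
    then show ?thesis
      by blast
  qed
next
  assume "\<exists>p xs. rigid_form x p xs"
  then obtain p xs where rf: "rigid_form x p xs"
    by blast
  then have nf: "is_normal_form x p xs"
    by (simp add: rigid_form_def)
  then have cl: "x \<in> carrier G"
    using Garside_closed by (simp add: is_normal_form_iff list_product_closed normal_list_carrier)
  show "rigid x"
  proof (cases "xs = []")
    case True
    then show ?thesis
      using nf cl Garside_closed by (auto simp: rigid_def is_normal_form_def)
  next
    case False
    then have "\<Delta> \<noteq> \<one>"
      using nf normal_form_trivial_Garside by blast
    then show ?thesis
      using rf cl False normal_form_eq[OF nf]
      by (simp add: rigid_def rigid_form_def final_factor_def initial_factor_def)
  qed
qed

text \<open>Here zs consists of copies of xs twisted by powers of \<^const>\<open>tau\<close>. Only the untwisted last copy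
  and the initial factor matter later.\<close>

lemma rigid_form_pow:
  assumes "rigid_form x p xs" "0 < k"
  obtains zs where "rigid_form (x [^] k) (int k * p) (zs @ xs)"
    "length (zs @ xs) = k * length xs"
    "xs \<noteq> [] \<Longrightarrow> tau_power (- (int k * p)) (hd (zs @ xs)) = tau_power (- p) (hd xs)"
proof -
  have nf: "x = \<Delta> [^] p \<otimes> list_product G xs" and nl: "normal_list xs"
    using assms by (auto simp: rigid_form_def is_normal_form_iff)
  have cl: "set xs \<subseteq> carrier G" "list_product G xs \<in> carrier G" "x \<in> carrier G"
    using nl Garside_closed by (auto simp: nf list_product_closed normal_list_carrier)
  have "\<exists>zs. rigid_form (x [^] k) (int k * p) (zs @ xs) \<and> length (zs @ xs) = k * length xs \<and>
    (xs \<noteq> [] \<longrightarrow> tau_power (- (int k * p)) (hd (zs @ xs)) = tau_power (- p) (hd xs))"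
    using assms(2)
  proof (induction k rule: nat_induct_non_zero)
    case 1
    then show ?case
      using assms(1) cl by (intro exI[of _ "[]"]) simp
  next
    case (Suc k)
    then obtain zs where rf: "rigid_form (x [^] k) (int k * p) (zs @ xs)"
      and len: "length (zs @ xs) = k * length xs"
      and ini: "xs \<noteq> [] \<Longrightarrow> tau_power (- (int k * p)) (hd (zs @ xs)) = tau_power (- p) (hd xs)"
      by blast
    \<comment> \<open>Multiplying by one more x on the right brings in \<Delta> to the p, which is
      moved left past all factors so far and twists them.\<close>
    define ws where "ws = map (tau_power p) (zs @ xs)"
    have nf': "x [^] k = \<Delta> [^] (int k * p) \<otimes> list_product G (zs @ xs)" and nl': "normal_list (zs @ xs)"
      using rf by (auto simp: rigid_form_def is_normal_form_iff)
    have cl': "set (zs @ xs) \<subseteq> carrier G" "list_product G (zs @ xs) \<in> carrier G"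
      using nl' list_product_closed normal_list_carrier by blast+
    have clws: "set ws \<subseteq> carrier G" "list_product G ws \<in> carrier G"
      using nl' normal_list_tau_power list_product_closed normal_list_carrier unfolding ws_def by blast+
    have "x [^] Suc k = \<Delta> [^] (int k * p) \<otimes> (list_product G (zs @ xs) \<otimes> \<Delta> [^] p) \<otimes> list_product G xs"
      using nf nf' cl cl'(2) Garside_closed by (simp only: nat_pow_Suc) (simp add: m_assoc)
    also have "\<dots> = (\<Delta> [^] (int k * p) \<otimes> \<Delta> [^] p) \<otimes> (list_product G ws \<otimes> list_product G xs)"
      using cl cl'(2) clws Garside_closed mult_Garside_pow[OF cl'(2)] tau_power_list_product[OF cl'(1)]
      by (simp only: ws_def[symmetric]) (simp add: m_assoc)
    also have "\<dots> = \<Delta> [^] (int (Suc k) * p) \<otimes> list_product G (ws @ xs)"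
      using cl clws Garside_closed int_pow_mult[OF Garside_closed, of "int k * p" p]
      by (simp add: list_product_append algebra_simps del: foldr_append)
    finally have eq: "x [^] Suc k = \<Delta> [^] (int (Suc k) * p) \<otimes> list_product G (ws @ xs)" .
    \<comment> \<open>This is the rigidity condition of x, twisted by p.\<close>
    have junction: "left_weighted (last ws) (hd xs)" if "xs \<noteq> []"
    proof -
      have "left_weighted (last xs) (tau_power (- p) (hd xs))"
        using assms(1) that by (simp add: rigid_form_def)
      then have "left_weighted (tau_power p (last xs)) (tau_power p (tau_power (- p) (hd xs)))"
        by (rule left_weighted_tau_power)
      moreover have "hd xs \<in> carrier G"
        using cl that by (cases xs) auto
      ultimately show ?thesis
        using that by (simp add: ws_def last_map tau_power_add tau_power_0)
    qed
    \<comment> \<open>The twist by p in ws cancels the growth of the exponent by p, so the initial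
      factor does not change with k.\<close>
    have ini': "tau_power (- (int (Suc k) * p)) (hd (ws @ xs)) = tau_power (- p) (hd xs)" if "xs \<noteq> []"
    proof -
      have "hd (zs @ xs) \<in> carrier G"
        using cl'(1) that by (metis append_is_Nil_conv hd_in_set subsetD)
      moreover have "hd (ws @ xs) = tau_power p (hd (zs @ xs))"
        using that by (simp add: ws_def hd_append hd_map)
      ultimately show ?thesis
        using ini[OF that] by (simp only: tau_power_add) (simp add: algebra_simps)
    qed
    have "normal_list (ws @ xs)"
      using nl normal_list_tau_power[OF nl', of p] junction
      by (simp only: normal_list_append[of ws xs] ws_def[symmetric]) blast
    moreover have len': "length (ws @ xs) = Suc k * length xs"
      using len by (simp add: ws_def)
    moreover have "left_weighted (last (ws @ xs)) (tau_power (- (int (Suc k) * p)) (hd (ws @ xs)))"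
      if "ws @ xs \<noteq> []"
    proof -
      have ne: "xs \<noteq> []"
        using that len' by auto
      show ?thesis
        unfolding ini'[OF ne] using assms(1) ne by (simp add: rigid_form_def)
    qed
    ultimately have "rigid_form (x [^] Suc k) (int (Suc k) * p) (ws @ xs)"
      using eq unfolding rigid_form_def is_normal_form_iff by blast
    then show ?case
      using ini' len' by blast
  qed
  then show thesis
    using that by blast
qed

lemma rigid_pow:
  assumes "rigid x" "0 < k"
  shows "rigid (x [^] (k::nat))"
  using assms rigid_form_pow unfolding rigid_iff by metis

text \<open>The normal form of the k-th power ends with that of its root and is k times as long, so
  the factors of the root can be read off; the exponent is divided by k.\<close>

lemma rigid_root_unique:
  assumes "rigid x" "rigid y" "0 < k" "x [^] (k::nat) = y [^] k"
  shows "x = y"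
proof -
  obtain p xs q ys where rf: "rigid_form x p xs" "rigid_form y q ys"
    using assms rigid_iff by blast
  obtain zs where zs: "rigid_form (x [^] k) (int k * p) (zs @ xs)" "length (zs @ xs) = k * length xs"
    using rigid_form_pow[OF rf(1) assms(3)] by blast
  obtain ws where ws: "rigid_form (y [^] k) (int k * q) (ws @ ys)" "length (ws @ ys) = k * length ys"
    using rigid_form_pow[OF rf(2) assms(3)] by blast
  have u: "zs @ xs = ws @ ys \<and> (\<Delta> \<noteq> \<one> \<longrightarrow> int k * p = int k * q)"
    using rigid_form_unique zs(1) ws(1) assms(4) by metis
  then have "length xs = length ys"
    using zs(2) ws(2) assms(3) by simp
  then have "xs = ys"
    using u by simp
  \<comment> \<open>For trivial \<Delta> the exponents need not agree, but the powers do.\<close>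
  moreover have "\<Delta> [^] p = \<Delta> [^] q"
    using u assms(3) by (cases "\<Delta> = \<one>") auto
  ultimately show ?thesis
    using rf by (simp add: rigid_form_def is_normal_form_iff)
qed

text \<open>Both powers end with the same factors and have the same initial factor, because these are
  visible in their common power, so dividing by the shorter one just removes a tail of the normal
  form of the longer one.\<close>

lemma rigid_pow_diff:
  assumes "y \<in> carrier G" "rigid (y [^] a)" "rigid (y [^] b)" "0 < b" "b < (a::nat)"
  shows "rigid (y [^] (a - b))"
proof -
  obtain p xs q ys where rf: "rigid_form (y [^] a) p xs" "rigid_form (y [^] b) q ys"
    using assms rigid_iff by blast
  obtain zs where zs: "rigid_form ((y [^] a) [^] b) (int b * p) (zs @ xs)"
    "length (zs @ xs) = b * length xs"
    "xs \<noteq> [] \<Longrightarrow> tau_power (- (int b * p)) (hd (zs @ xs)) = tau_power (- p) (hd xs)"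
    using rigid_form_pow[OF rf(1) assms(4)] by blast
  obtain ws where ws: "rigid_form ((y [^] b) [^] a) (int a * q) (ws @ ys)"
    "length (ws @ ys) = a * length ys"
    "ys \<noteq> [] \<Longrightarrow> tau_power (- (int a * q)) (hd (ws @ ys)) = tau_power (- q) (hd ys)"
    using rigid_form_pow[OF rf(2), of a] assms(4,5) by force
  have "(y [^] a) [^] b = (y [^] b) [^] a"
    using assms(1) by (simp add: nat_pow_pow mult.commute)
  then have u: "zs @ xs = ws @ ys \<and> (\<Delta> \<noteq> \<one> \<longrightarrow> int b * p = int a * q)"
    using rigid_form_unique zs(1) ws(1) by metis
  then have len: "b * length xs = a * length ys"
    using zs(2) ws(2) by simp
  have "length ys \<le> length xs"
  proof (rule ccontr)
    assume "\<not> length ys \<le> length xs"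
    then have "b * length xs < b * length ys"
      using assms(4) by simp
    also have "\<dots> \<le> a * length ys"
      using assms(5) by simp
    finally show False
      using len by simp
  qed
  \<comment> \<open>Both lists are tails of the normal form of the common power, so the shorter is a
    tail of the longer.\<close>
  then obtain us where us: "xs = us @ ys"
    using u by (auto simp: append_eq_append_conv2)
  have nl: "normal_list us" "normal_list ys"
    and lw: "us \<noteq> [] \<Longrightarrow> ys \<noteq> [] \<Longrightarrow> left_weighted (last us) (hd ys)"
    and ya: "y [^] a = \<Delta> [^] p \<otimes> list_product G xs" and yb: "y [^] b = \<Delta> [^] q \<otimes> list_product G ys"
    using rf by (auto simp: rigid_form_def is_normal_form_iff us normal_list_append)
  have cl: "set us \<subseteq> carrier G" "set ys \<subseteq> carrier G"
    "list_product G us \<in> carrier G" "list_product G ys \<in> carrier G"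
    using nl by (auto simp: list_product_closed dest: normal_list_carrier)
  \<comment> \<open>Dividing by the b-th power on the right removes ys and leaves \<Delta> to the -q
    behind us; moving it to the front twists us by -q.\<close>
  define vs where "vs = map (tau_power (- q)) us"
  have vs: "normal_list vs" "list_product G vs \<in> carrier G"
    using normal_list_tau_power[OF nl(1)] list_product_closed[OF normal_list_carrier]
    unfolding vs_def by blast+
  have "\<Delta> [^] (p - q) \<otimes> list_product G vs \<otimes> y [^] b =
      \<Delta> [^] (p - q) \<otimes> (list_product G vs \<otimes> \<Delta> [^] q) \<otimes> list_product G ys"
    using cl vs Garside_closed by (simp add: yb m_assoc)
  also have "\<dots> = \<Delta> [^] (p - q) \<otimes> \<Delta> [^] q \<otimes> (tau_power q (list_product G vs) \<otimes> list_product G ys)"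
    using cl vs Garside_closed by (simp add: mult_Garside_pow[OF vs(2)] m_assoc)
  also have "tau_power q (list_product G vs) = list_product G us"
    using cl tau_power_list_product[OF cl(1), of "- q"]
    by (simp add: vs_def tau_power_add tau_power_0 flip: tau_power_list_product)
  also have "\<Delta> [^] (p - q) \<otimes> \<Delta> [^] q \<otimes> (list_product G us \<otimes> list_product G ys) = y [^] a"
    using cl Garside_closed
    by (simp add: ya us list_product_append int_pow_mult[symmetric] del: foldr_append)
  also have "y [^] a = y [^] (a - b) \<otimes> y [^] b"
    using assms by (simp add: nat_pow_mult)
  finally have eq: "y [^] (a - b) = \<Delta> [^] (p - q) \<otimes> list_product G vs"
    using assms(1) vs Garside_closed by simp
  \<comment> \<open>The initial factor of the quotient is that of the a-th power, hence that of the
    b-th: the head of ys twisted by -q. The condition is thus the junction of us and ys inside xs,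
    twisted by -q.\<close>
  have "left_weighted (last vs) (tau_power (- (p - q)) (hd vs))" if "vs \<noteq> []"
  proof -
    have ne: "us \<noteq> []" "xs \<noteq> []" "ys \<noteq> []"
      using that len assms(4,5) by (auto simp: vs_def us)
    have hd: "hd us \<in> carrier G"
      using cl(1) ne(1) hd_in_set by blast
    have "\<Delta> \<noteq> \<one>"
      using rf(1) ne(2) normal_form_trivial_Garside by (auto simp: rigid_form_def)
    have "tau_power (- (p - q)) (hd vs) = tau_power (- p) (hd us)"
      using ne hd by (simp add: vs_def hd_map tau_power_add)
    also have "\<dots> = tau_power (- p) (hd xs)"
      using ne by (simp add: us)
    also have "\<dots> = tau_power (- q) (hd ys)"
      using zs(3) ws(3) ne u \<open>\<Delta> \<noteq> \<one>\<close> by simp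
    finally show ?thesis
      using left_weighted_tau_power[OF lw[OF ne(1,3)], of "- q"] ne by (simp add: vs_def last_map)
  qed
  then have "rigid_form (y [^] (a - b)) (p - q) vs"
    using eq vs by (simp add: rigid_form_def is_normal_form_iff)
  then show ?thesis
    using rigid_iff by blast
qed

text \<open>Subtracting r from a larger rigid exponent n leaves a rigid exponent by
  \<open>rigid_pow_diff\<close>; by minimality the descent never goes below r, so it ends at r
  itself.\<close>

lemma rigidity_exponent_dvd:
  assumes "y \<in> carrier G" "rigid (y [^] n)" "0 < n"
  shows "rigidity_exponent y dvd n" "0 < rigidity_exponent y" "rigid (y [^] rigidity_exponent y)"
proof -
  define r where "r = rigidity_exponent y"
  have r: "0 < r" "rigid (y [^] r)"
    using LeastI[of "\<lambda>k. 1 \<le> k \<and> rigid (y [^] k)" n] assms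
    by (auto simp: r_def rigidity_exponent_def)
  have least: "r \<le> k" if "0 < k" "rigid (y [^] k)" for k
    using that by (auto simp: r_def rigidity_exponent_def intro: Least_le)
  show "0 < rigidity_exponent y" "rigid (y [^] rigidity_exponent y)"
    using r by (auto simp: r_def)
  have "r dvd n"
    using assms(2,3)
  proof (induction n rule: less_induct)
    case (less n)
    show ?case
    proof (cases "n = r")
      case False
      then have "r < n"
        using least[OF less.prems(2,1)] by simp
      then have "r dvd n - r"
        using less.IH[of "n - r"] rigid_pow_diff[OF assms(1) less.prems(1) r(2)] r(1) by simp
      then show ?thesis
        using \<open>r < n\<close> by (simp add: dvd_minus_self)
    qed simp
  qed
  then show "rigidity_exponent y dvd n"
    by (simp add: r_def)
qed

section \<open>Conjugacy and the comparison of the sets of rigid conjugates\<close>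

lemma conj_nat_pow:
  assumes "g \<in> carrier G" "x \<in> carrier G"
  shows "(inv g \<otimes> x \<otimes> g) [^] (n::nat) = inv g \<otimes> x [^] n \<otimes> g"
  using assms by (induction n) (simp_all add: m_assoc mult_inv_cancel)

lemma conjugate_pow:
  assumes "x \<in> carrier G" "conjugate G x y"
  shows "conjugate G (x [^] (n::nat)) (y [^] n)"
  using assms conj_nat_pow by (auto simp: conjugate_def)

lemma conjugate_sym:
  assumes "x \<in> carrier G" "conjugate G x y"
  shows "conjugate G y x"
proof -
  obtain g where g: "g \<in> carrier G" "y = inv g \<otimes> x \<otimes> g"
    using assms by (auto simp: conjugate_def)
  then have "x = inv (inv g) \<otimes> y \<otimes> inv g"
    using assms(1) by (simp add: m_assoc mult_inv_cancel)
  then show ?thesis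
    using g(1) unfolding conjugate_def by blast
qed

lemma bij_betw_SC_pow:
  assumes x: "rigid x" and n: "0 < n"
    and bound: "\<And>y. y \<in> carrier G \<Longrightarrow> conjugate G y x \<Longrightarrow> has_rigid_power y \<Longrightarrow>
      rigidity_exponent y dvd N"
  shows "bij_betw (\<lambda>w. w [^] (n div gcd n N)) (SC (x [^] gcd n N)) (SC (x [^] n))"
proof -
  let ?d = "gcd n N"
  let ?k = "n div ?d"
  have xc: "x \<in> carrier G"
    using x by (simp add: rigid_def)
  have d: "0 < ?d" "?d * ?k = n" "0 < ?k"
    using n by (auto simp: div_greater_zero_iff dvd_imp_le)
  have "inj_on (\<lambda>w. w [^] ?k) (SC (x [^] ?d))"
    using rigid_root_unique d(3) by (auto simp: inj_on_def SC_def)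
  moreover have "(\<lambda>w. w [^] ?k) ` SC (x [^] ?d) \<subseteq> SC (x [^] n)"
  proof
    fix z assume "z \<in> (\<lambda>w. w [^] ?k) ` SC (x [^] ?d)"
    then obtain w where w: "rigid w" "conjugate G (x [^] ?d) w" "z = w [^] ?k"
      by (auto simp: SC_def)
    then show "z \<in> SC (x [^] n)"
      using rigid_pow[OF w(1) d(3)] conjugate_pow[of "x [^] ?d" w ?k] xc d(2)
      by (simp add: SC_def nat_pow_pow)
  qed
  moreover have "z \<in> (\<lambda>w. w [^] ?k) ` SC (x [^] ?d)" if "z \<in> SC (x [^] n)" for z
  proof -
    have z: "rigid z" "conjugate G (x [^] n) z"
      using that by (auto simp: SC_def)
    then obtain g where g: "g \<in> carrier G" "z = inv g \<otimes> x [^] n \<otimes> g"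
      by (auto simp: conjugate_def)
    \<comment> \<open>The element conjugating the n-th power of x to z also conjugates x itself,
      which yields an n-th root of z.\<close>
    define y where "y = inv g \<otimes> x \<otimes> g"
    have y: "y \<in> carrier G" "conjugate G x y" "z = y [^] n"
      using g xc conj_nat_pow by (auto simp: y_def conjugate_def)
    have "has_rigid_power y"
      using z y n by (auto simp: has_rigid_power_def intro!: exI[of _ n])
    then have "rigidity_exponent y dvd N"
      using bound y xc conjugate_sym by blast
    \<comment> \<open>The exponent r(y) divides n because z is rigid, and N by assumption, so it
      divides their gcd; the corresponding power of y is therefore a power of a rigid
      element.\<close>
    then obtain j where j: "?d = rigidity_exponent y * j"
      using rigidity_exponent_dvd(1)[of y n] y z(1) n by (metis gcd_greatest dvdE)
    have re: "rigid (y [^] rigidity_exponent y)"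
      using rigidity_exponent_dvd(3)[of y n] y z(1) n by simp
    have "rigid (y [^] ?d)"
      using rigid_pow[OF re, of j] d(1) j y(1) by (simp add: nat_pow_pow)
    then have "y [^] ?d \<in> SC (x [^] ?d)"
      using conjugate_pow xc y(2) by (simp add: SC_def)
    moreover have "z = (y [^] ?d) [^] ?k"
      using y d(2) by (simp add: nat_pow_pow)
    ultimately show ?thesis
      by blast
  qed
  ultimately show ?thesis
    by (auto simp: bij_betw_def)
qed

end

theorem proposition1p9:
  fixes G :: "('a, 'b) monoid_scheme" and P :: "'a set" and \<Delta> :: 'a
  assumes "garside_structure G P \<Delta>"
    and "roots_unique_up_to_conjugacy G"
    and "\<exists>R::int. \<forall>y\<in>carrier G.
           (\<exists>z. garside_structure.rigid G P \<Delta> z \<and> conjugate G y z) \<longrightarrow>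
           garside_structure.has_rigid_power G P \<Delta> y \<longrightarrow>
           int (garside_structure.rigidity_exponent G P \<Delta> y) \<le> R"
  shows "\<exists>PG::nat set. finite PG \<and> (\<forall>r\<in>PG. 0 < r) \<and>
           (\<forall>x. garside_structure.rigid G P \<Delta> x \<longrightarrow>
              (\<exists>r\<in>PG. periodic_of_period
                 (\<lambda>n. card (garside_structure.SC G P \<Delta> (x [^]\<^bsub>G\<^esub> n))) r))"
proof -
  interpret garside_structure G P \<Delta>
    by (rule assms(1))
  obtain R :: int where R: "\<And>y z. y \<in> carrier G \<Longrightarrow> rigid z \<Longrightarrow> conjugate G y z \<Longrightarrow>
      has_rigid_power y \<Longrightarrow> int (rigidity_exponent y) \<le> R"
    using assms(3) by blast
  \<comment> \<open>A multiple of every positive integer up to R, chosen independently of x; it is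
    positive even when R is negative.\<close>
  define N :: nat where "N = fact (nat R)"
  have "periodic_of_period (\<lambda>n. card (SC (x [^]\<^bsub>G\<^esub> n))) N" if x: "rigid x" for x
  proof -
    have dvd: "rigidity_exponent y dvd N"
      if y: "y \<in> carrier G" "conjugate G y x" "has_rigid_power y" for y
    proof -
      \<comment> \<open>Positivity is needed, since only positive integers up to R divide the
        factorial.\<close>
      have "0 < rigidity_exponent y"
        using y rigidity_exponent_dvd(2)[of y] by (auto simp: has_rigid_power_def)
      then show ?thesis
        using R[OF y(1) x y(2,3)] by (auto simp: N_def intro: dvd_fact)
    qed
    have gcd: "card (SC (x [^]\<^bsub>G\<^esub> n)) = card (SC (x [^]\<^bsub>G\<^esub> gcd n N))" if "0 < n" for n
      using bij_betw_same_card[OF bij_betw_SC_pow[OF x that dvd]] by simp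
    show ?thesis
      unfolding periodic_of_period_def
    proof (intro allI impI)
      fix n :: nat assume "1 \<le> n"
      then show "card (SC (x [^]\<^bsub>G\<^esub> (n + N))) = card (SC (x [^]\<^bsub>G\<^esub> n))"
        using gcd[of n] gcd[of "n + N"] by (metis add_gr_0 gcd_add1 less_eq_Suc_le One_nat_def)
    qed
  qed
  \<comment> \<open>One period serves all rigid elements, so a singleton suffices.\<close>
  then show ?thesis
    by (intro exI[of _ "{N}"]) (simp add: N_def)
qed

end
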